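(* Let $m$ be an odd positive integer and let $F:\mathbb{F}_{2^m}^3\to\mathbb{F}_{2^m}^3$ be defined by $F(x,y,z)=(f(x,y,z),f(y,z,x),f(z,x,y))$, where $f(x,y,z)=x^3+y^3+x^2y+x^2z+yz^2$. Then $F$ is a permutation of $\mathbb{F}_{2^m}^3$.
   Context: $\mathbb{F}_{2^m}$ denotes the finite field with $2^m$ elements and $\mathbb{F}_{2^m}^3$ the 3-dimensional vector space over it. A permutation of $\mathbb{F}_{2^m}^3$ is a bijection from $\mathbb{F}_{2^m}^3$ to itself. *)

theory Defs
  imports "HOL-Library.Cardinality"
begin

definition cubic_f :: "'a::field \<Rightarrow> 'a \<Rightarrow> 'a \<Rightarrow> 'a" where
  "cubic_f x y z = x ^ 3 + y ^ 3 + x ^ 2 * y + x ^ 2 * z + y * z ^ 2"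

definition cubic_F :: "'a::field \<times> 'a \<times> 'a \<Rightarrow> 'a \<times> 'a \<times> 'a" where
  "cubic_F = (\<lambda>(x, y, z). (cubic_f x y z, cubic_f y z x, cubic_f z x y))"

end

theory Submission
  imports Defs "HOL-Number_Theory.Cong"
begin

text \<open>
  Put \<open>s = x + y + z\<close>, \<open>p = y + z\<close>, \<open>q = z + x\<close> and \<open>N = p\<^sup>2 + p q + q\<^sup>2\<close>. In characteristic 2 the
  first coordinate of the map equals \<open>s\<^sup>3 + p\<^sup>2 q\<close>, and adding coordinates eliminates \<open>s\<close>:
  \<open>F\<^sub>1 + F\<^sub>3 = p N\<close> and \<open>F\<^sub>1 + F\<^sub>2 = q N\<close>. Applying the quadratic form to \<open>(p N, q N)\<close> gives \<open>N\<^sup>3\<close>.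
  For odd \<open>m\<close> there is no primitive cube root of unity, so cubing is injective and the quadratic
  form is anisotropic; hence the image determines \<open>N\<close>, then \<open>(p, q)\<close>, then \<open>s\<^sup>3\<close> and \<open>s\<close>.
\<close>

text \<open>Multiplication by \<open>w\<close> permutes the nonzero elements, so their nonzero
  product is unchanged when every factor is multiplied by \<open>w\<close>.\<close>

lemma finite_field_power_card_minus_1:
  fixes w :: "'a::{field,finite}"
  assumes "w \<noteq> 0"
  shows "w ^ (CARD('a) - 1) = 1"
proof -
  let ?U = "UNIV - {0 :: 'a}"
  have "bij_betw (\<lambda>x. w * x) ?U ?U"
    by (rule bij_betw_byWitness[where f' = "\<lambda>x. x / w"]) (use assms in auto)
  then have "(\<Prod>x\<in>?U. w * x) = \<Prod>?U"
    by (rule prod.reindex_bij_betw)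
  then have "w ^ card ?U * \<Prod>?U = \<Prod>?U"
    by (simp add: prod.distrib)
  moreover have "\<Prod>?U \<noteq> 0"
    by simp
  ultimately show ?thesis
    by (simp add: card_Diff_singleton)
qed

text \<open>Translation by 1 permutes the field; comparing sums over the field shows that its
  cardinality, a power of 2, vanishes in it.\<close>

lemma two_eq_zero_if_card_power_2:
  assumes "CARD('a::{field,finite}) = 2 ^ m"
  shows "(2 :: 'a) = 0"
proof -
  have "(\<Sum>x\<in>UNIV. x + 1) = (\<Sum>x\<in>UNIV. x :: 'a)"
    by (rule sum.reindex_bij_betw, rule bij_betw_byWitness[where f' = "\<lambda>x. x - 1"]) auto
  then have "of_nat CARD('a) = (0 :: 'a)"
    by (simp add: sum.distrib)
  then show ?thesis
    using assms by simp
qed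

lemma quadratic_form_anisotropic:
  fixes p q :: "'a::{field,finite}"
  assumes "odd m" and card: "CARD('a) = 2 ^ m"
    and zero: "p\<^sup>2 + p * q + q\<^sup>2 = 0"
  shows "p = 0 \<and> q = 0"
proof -
  have two: "(2 :: 'a) = 0"
    using card by (rule two_eq_zero_if_card_power_2)
  have "q = 0"
  proof (rule ccontr)
    assume q: "q \<noteq> 0"
    \<comment> \<open>Dehomogenizing turns a nontrivial zero of the form into a root of
      \<open>w\<^sup>2 + w + 1\<close>, hence a cube root of unity.\<close>
    define w where "w = p / q"
    have w: "w\<^sup>2 + w + 1 = 0"
      using zero q by (simp add: w_def power2_eq_square field_simps)
    have "w ^ 3 - 1 = (w - 1) * (w\<^sup>2 + w + 1)"
      by algebra
    then have w3: "w ^ 3 = 1"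
      using w by simp
    obtain k where k: "m = 2 * k + 1"
      using \<open>odd m\<close> by (elim oddE)
    have "[(4::nat) ^ k = 1 ^ k] (mod 3)"
      by (rule cong_pow) (simp add: cong_def)
    then have "(4::nat) ^ k mod 3 = 1"
      by (simp add: cong_def)
    then obtain j where j: "(4::nat) ^ k = 3 * j + 1"
      by (metis mult_div_mod_eq)
    \<comment> \<open>Since \<open>2 ^ m = 2 * 4 ^ k = 6 * j + 2\<close>, the order of the
      multiplicative group is 1 modulo 3, which together with \<open>w ^ 3 = 1\<close> forces
      \<open>w = 1\<close>.\<close>
    have "CARD('a) - 1 = 3 * (2 * j) + 1"
      using j by (simp add: card k power_mult)
    moreover have "w \<noteq> 0"
      using w by auto
    ultimately have "w ^ (3 * (2 * j) + 1) = 1"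
      using finite_field_power_card_minus_1 by metis
    then have "w = 1"
      by (simp only: power_add power_mult w3 power_one power_one_right mult_1)
    then have "(2 :: 'a) + 1 = 0"
      using w by simp
    then show False
      using two by simp
  qed
  then show ?thesis
    using zero by simp
qed

text \<open>The cofactor of \<open>x - y\<close> in \<open>x ^ 3 - y ^ 3\<close> is the anisotropic
  form.\<close>

lemma cube_injective:
  fixes x y :: "'a::{field,finite}"
  assumes "odd m" and "CARD('a) = 2 ^ m" and "x ^ 3 = y ^ 3"
  shows "x = y"
proof -
  have "(x - y) * (x\<^sup>2 + x * y + y\<^sup>2) = x ^ 3 - y ^ 3"
    by (simp add: power2_eq_square power3_eq_cube algebra_simps)
  then have "x - y = 0 \<or> x\<^sup>2 + x * y + y\<^sup>2 = 0"
    using assms(3) by simp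
  then show ?thesis
    using quadratic_form_anisotropic[OF assms(1,2), of x y] by (elim disjE) simp_all
qed

lemma norm_scaling_injective:
  fixes p q p' q' :: "'a::{field,finite}"
  assumes m: "odd m" "CARD('a) = 2 ^ m"
    and N: "N = p\<^sup>2 + p * q + q\<^sup>2" and N': "N' = p'\<^sup>2 + p' * q' + q'\<^sup>2"
    and p: "p * N = p' * N'" and q: "q * N = q' * N'"
  shows "p = p' \<and> q = q'"
proof -
  have scale: "(a * n)\<^sup>2 + (a * n) * (b * n) + (b * n)\<^sup>2 = (a\<^sup>2 + a * b + b\<^sup>2) * n\<^sup>2"
    for a b n :: 'a
    by algebra
  have "N ^ 3 = (p * N)\<^sup>2 + (p * N) * (q * N) + (q * N)\<^sup>2"
    unfolding scale N[symmetric] by (simp only: power2_eq_square power3_eq_cube mult.assoc)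
  also have "\<dots> = N' ^ 3"
    unfolding p q scale N'[symmetric] by (simp only: power2_eq_square power3_eq_cube mult.assoc)
  finally have eq: "N = N'"
    by (rule cube_injective[OF m])
  show ?thesis
  proof (cases "N = 0")
    \<comment> \<open>No division by \<open>N\<close> is possible here, but both forms vanish, so
      anisotropy makes both pairs zero.\<close>
    case True
    then show ?thesis
      using quadratic_form_anisotropic[OF m] N N' eq by metis
  next
    case False
    then show ?thesis
      using p q eq by simp
  qed
qed

text \<open>As rewrite rules these cancel equal monomials once \<open>algebra_simps\<close> has
  sorted them next to each other; the second handles a pair followed by further summands.\<close>

lemma add_self_char_2:
  fixes a b :: "'a::comm_ring_1"
  assumes "(2 :: 'a) = 0"
  shows "a + a = 0" and "a + (a + b) = b"
proof -
  show "a + a = 0"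
    using assms by (metis mult_2 mult_zero_left)
  then show "a + (a + b) = b"
    by (simp flip: add.assoc)
qed

lemma cubic_f_char_2:
  fixes x y z :: "'a::field"
  assumes "(2 :: 'a) = 0"
  shows "cubic_f x y z = (x + y + z) ^ 3 + (y + z)\<^sup>2 * (z + x)"
  by (simp only: cubic_f_def power2_eq_square power3_eq_cube algebra_simps
      add_self_char_2[OF assms] add_0_left add_0_right)

lemma cubic_f_sums_char_2:
  fixes x y z :: "'a::field"
  assumes "(2 :: 'a) = 0" and "p = y + z" and "q = z + x"
  shows "cubic_f x y z + cubic_f z x y = p * (p\<^sup>2 + p * q + q\<^sup>2)"
    and "cubic_f x y z + cubic_f y z x = q * (p\<^sup>2 + p * q + q\<^sup>2)"
  by (simp_all only: assms(2,3) cubic_f_def power2_eq_square power3_eq_cube algebra_simps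
      add_self_char_2[OF assms(1)] add_0_left add_0_right)

theorem theorem4:
  fixes m :: nat
  assumes "odd m"
    and "CARD('a::{field,finite}) = 2 ^ m"
  shows "bij (cubic_F :: 'a \<times> 'a \<times> 'a \<Rightarrow> 'a \<times> 'a \<times> 'a)"
proof -
  note two = two_eq_zero_if_card_power_2[OF assms(2)]
  have inj: "x = x' \<and> y = y' \<and> z = z'"
    if f: "cubic_f x y z = cubic_f x' y' z'" "cubic_f y z x = cubic_f y' z' x'"
      "cubic_f z x y = cubic_f z' x' y'"
    for x y z x' y' z' :: 'a
  proof -
    have "y + z = y' + z' \<and> z + x = z' + x'"
      by (rule norm_scaling_injective[OF assms refl refl])
        (simp_all only: cubic_f_sums_char_2[OF two refl refl, symmetric] f)
    then have pq: "y + z = y' + z'" "z + x = z' + x'"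
      by blast+
    \<comment> \<open>The summand \<open>(y + z)\<^sup>2 * (z + x)\<close> is now common to both
      sides and cancels.\<close>
    have "(x + y + z) ^ 3 = (x' + y' + z') ^ 3"
      using f(1) unfolding cubic_f_char_2[OF two] pq by (rule add_right_imp_eq)
    then have "x + y + z = x' + y' + z'"
      by (rule cube_injective[OF assms])
    then have x: "x = x'"
      unfolding add.assoc pq by (rule add_right_imp_eq)
    have z: "z = z'"
      using pq(2) unfolding x by (rule add_right_imp_eq)
    have "y = y'"
      using pq(1) unfolding z by (rule add_right_imp_eq)
    with x z show ?thesis
      by blast
  qed
  have "inj (cubic_F :: 'a \<times> 'a \<times> 'a \<Rightarrow> 'a \<times> 'a \<times> 'a)"
  proof (rule injI)
    fix u v :: "'a \<times> 'a \<times> 'a"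
    assume eq: "cubic_F u = cubic_F v"
    obtain x y z where u: "u = (x, y, z)"
      by (rule prod_cases3)
    obtain x' y' z' where v: "v = (x', y', z')"
      by (rule prod_cases3)
    show "u = v"
      using eq inj[of x y z x' y' z'] unfolding u v cubic_F_def prod.case prod.inject by blast
  qed
  then show ?thesis
    by (intro bijI finite_UNIV_inj_surj finite)
qed

end
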